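(* Let $\mathcal{G}(\mathcal{V},\mathcal{E})$ be a chordal graph with node set $\mathcal{V}=\{1,\ldots,n\}$ and maximal cliques $\mathcal{C}_1,\mathcal{C}_2,\ldots,\mathcal{C}_t$. Then, for every polynomial $p\in\mathbb{R}[x]_{n,2d}$, $$p(x)\in \mathit{SSOS}_{n,2d}(\mathcal{E}) \iff p(x)=\sum_{k=1}^{t} p_k(E_{\mathcal{C}_k}x),$$ where, for each $k=1,\ldots,t$, $p_k(E_{\mathcal{C}_k}x)$ is a sum-of-squares (SOS) polynomial in the subset of variables $E_{\mathcal{C}_k}x$.
   Context: Graphs. $\mathcal{G}(\mathcal{V},\mathcal{E})$ is an undirected graph: $\mathcal{E}\subseteq\mathcal{V}\times\mathcal{V}$ and $(i,j)\in\mathcal{E}$ implies $(j,i)\in\mathcal{E}$. It is chordal if every cycle of length at least $4$ has a chord (an edge between two nonconsecutive nodes of the cycle). A clique is a subset $\mathcal{C}\subseteq\mathcal{V}$ with $(i,j)\in\mathcal{E}$ for all $i,j\in\mathcal{C}$, $i\neq j$; it is maximal if it is not contained in any other clique. Index matrices. For a maximal clique $\mathcal{C}_k$, $E_{\mathcal{C}_k}\in\mathbb{R}^{|\mathcal{C}_k|\times n}$ is the matrix with $(E_{\mathcal{C}_k})_{ij}=1$ if $\mathcal{C}_k(i)=j$ and $0$ otherwise, where $\mathcal{C}_k(i)$ is the $i$-th node of $\mathcal{C}_k$ in the natural ordering. Thus $E_{\mathcal{C}_k}x$ is the vector of the variables $x_j$, $j\in\mathcal{C}_k$. Polynomials. $\mathbb{R}[x]_{n,2d}$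 is the set of real polynomials in $x=(x_1,\ldots,x_n)$ of degree at most $2d$. A polynomial is SOS if it is a finite sum of squares of real polynomials (in the indicated variables). For a multi-index $\alpha\in\mathbb{N}^n$, $x^\alpha=\prod_i x_i^{\alpha_i}$ and $|\alpha|=\sum_i\alpha_i$; $\mathbb{N}^n_d=\{\alpha\in\mathbb{N}^n: |\alpha|\le d\}$. $v_d(x)$ is the vector of all monomials $x^\alpha$, $\alpha\in\mathbb{N}^n_d$. Symmetric matrices $Q$ of size $\binom{n+d}{d}$ are indexed by pairs $\beta,\gamma\in\mathbb{N}^n_d$. Sparse SOS polynomials. $\mathit{SSOS}_{n,2d}(\mathcal{E})$ is the set of $p\in\mathbb{R}[x]_{n,2d}$ for which there is a positive semidefinite matrix $Q$ with $p(x)=v_d(x)^{\mathsf T}Q\,v_d(x)$ and $Q_{\beta,\gamma}=0$ whenever there exist $i\neq j$ with $(i,j)\notin\mathcal{E}$, $\beta_i+\gamma_i\neq0$ and $\beta_j+\gamma_j\neq0$. *)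

theory Defs
  imports Complex_Main "HOL-Library.Poly_Mapping"
begin

section \<open>Graphs\<close>

text \<open>Self-loops are permitted; they are irrelevant for all notions below.\<close>

definition undirected_graph :: "'a set \<Rightarrow> ('a \<times> 'a) set \<Rightarrow> bool" where
  "undirected_graph V E \<longleftrightarrow> E \<subseteq> V \<times> V \<and> sym E"

definition is_cycle :: "('a \<times> 'a) set \<Rightarrow> 'a list \<Rightarrow> bool" where
  "is_cycle E xs \<longleftrightarrow> 3 \<le> length xs \<and> distinct xs \<and>
     (\<forall>i<length xs. (xs ! i, xs ! (Suc i mod length xs)) \<in> E)"

definition has_chord :: "('a \<times> 'a) set \<Rightarrow> 'a list \<Rightarrow> bool" where
  "has_chord E xs \<longleftrightarrow>
     (\<exists>i<length xs. \<exists>j<length xs. i \<noteq> j \<and>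
        j \<noteq> Suc i mod length xs \<and> i \<noteq> Suc j mod length xs \<and> (xs ! i, xs ! j) \<in> E)"

definition chordal :: "('a \<times> 'a) set \<Rightarrow> bool" where
  "chordal E \<longleftrightarrow> (\<forall>xs. is_cycle E xs \<and> 4 \<le> length xs \<longrightarrow> has_chord E xs)"

definition clique :: "'a set \<Rightarrow> ('a \<times> 'a) set \<Rightarrow> 'a set \<Rightarrow> bool" where
  "clique V E C \<longleftrightarrow> C \<subseteq> V \<and> (\<forall>i\<in>C. \<forall>j\<in>C. i \<noteq> j \<longrightarrow> (i, j) \<in> E)"

definition maximal_clique :: "'a set \<Rightarrow> ('a \<times> 'a) set \<Rightarrow> 'a set \<Rightarrow> bool" where
  "maximal_clique V E C \<longleftrightarrow> clique V E C \<and> (\<nexists>D. clique V E D \<and> C \<subset> D)"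

section \<open>Real polynomials in several variables\<close>

text \<open>
  Variables are indexed by natural numbers. A multi-index is a finitely supported function
  from variable indices to exponents, and a polynomial is a finitely supported function from
  multi-indices to coefficients; ring operations are those of \<^theory>\<open>HOL-Library.Poly_Mapping\<close>
  (multiplication is convolution). The variables \<open>x\<^sub>1, \<dots>, x\<^sub>n\<close> are numbered from 1.
\<close>

type_synonym multi_index = "nat \<Rightarrow>\<^sub>0 nat"
type_synonym real_mpoly = "multi_index \<Rightarrow>\<^sub>0 real"

definition multi_indices :: "nat \<Rightarrow> nat \<Rightarrow> multi_index set" where
  "multi_indices n d = {\<alpha>. Poly_Mapping.keys \<alpha> \<subseteq> {1..n} \<and> (\<Sum>i=1..n. Poly_Mapping.lookup \<alpha> i) \<le> d}"

definition poly_const :: "real \<Rightarrow> real_mpoly" where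
  "poly_const c = Poly_Mapping.single 0 c"

definition poly_monom :: "multi_index \<Rightarrow> real_mpoly" where
  "poly_monom \<alpha> = Poly_Mapping.single \<alpha> 1"

definition poly_var :: "nat \<Rightarrow> real_mpoly" where
  "poly_var i = poly_monom (Poly_Mapping.single i 1)"

definition polys_upto :: "nat \<Rightarrow> nat \<Rightarrow> real_mpoly set" where
  "polys_upto n D = {p. Poly_Mapping.keys p \<subseteq> multi_indices n D}"

definition polys_in :: "nat set \<Rightarrow> real_mpoly set" where
  "polys_in S = {p. \<forall>\<alpha>\<in>Poly_Mapping.keys p. Poly_Mapping.keys \<alpha> \<subseteq> S}"

definition poly_subst :: "real_mpoly \<Rightarrow> (nat \<Rightarrow> real_mpoly) \<Rightarrow> real_mpoly" where
  "poly_subst p f =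
     (\<Sum>\<alpha>\<in>Poly_Mapping.keys p. poly_const (Poly_Mapping.lookup p \<alpha>) * (\<Prod>i\<in>Poly_Mapping.keys \<alpha>. f i ^ Poly_Mapping.lookup \<alpha> i))"

definition sos_in :: "nat set \<Rightarrow> real_mpoly \<Rightarrow> bool" where
  "sos_in S p \<longleftrightarrow> (\<exists>qs. set qs \<subseteq> polys_in S \<and> p = (\<Sum>q\<leftarrow>qs. q ^ 2))"

section \<open>Index matrices of cliques\<close>

text \<open>
  Row indices range over \<open>{1..card C}\<close> and column indices over \<open>{1..n}\<close>. List positions start
  at 0, whence the shift by one.
\<close>

definition index_matrix :: "nat set \<Rightarrow> nat \<Rightarrow> nat \<Rightarrow> real" where
  "index_matrix C i j = (if sorted_list_of_set C ! (i - 1) = j then 1 else 0)"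

text \<open>The components, as polynomials in \<open>x\<close>, of the product of the index matrix with
  \<open>x = (x\<^sub>1, \<dots>, x\<^sub>n)\<close>.\<close>

definition clique_vars :: "nat \<Rightarrow> nat set \<Rightarrow> nat \<Rightarrow> real_mpoly" where
  "clique_vars n C i = (\<Sum>j=1..n. poly_const (index_matrix C i j) * poly_var j)"

section \<open>Sparse sums of squares\<close>

text \<open>Matrices with rows and columns indexed by a finite set \<open>I\<close>; entries outside
  \<open>I \<times> I\<close> are ignored.\<close>

definition psd_on :: "'i set \<Rightarrow> ('i \<Rightarrow> 'i \<Rightarrow> real) \<Rightarrow> bool" where
  "psd_on I Q \<longleftrightarrow> (\<forall>\<beta>\<in>I. \<forall>\<gamma>\<in>I. Q \<beta> \<gamma> = Q \<gamma> \<beta>) \<and>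
     (\<forall>v :: 'i \<Rightarrow> real. 0 \<le> (\<Sum>\<beta>\<in>I. \<Sum>\<gamma>\<in>I. v \<beta> * Q \<beta> \<gamma> * v \<gamma>))"

text \<open>The parameter \<open>d\<close> of \<open>SSOS n d E\<close> is half the degree bound.\<close>

definition SSOS :: "nat \<Rightarrow> nat \<Rightarrow> (nat \<times> nat) set \<Rightarrow> real_mpoly set" where
  "SSOS n d E = {p \<in> polys_upto n (2 * d). \<exists>Q.
     psd_on (multi_indices n d) Q \<and>
     p = (\<Sum>\<beta>\<in>multi_indices n d. \<Sum>\<gamma>\<in>multi_indices n d.
            poly_monom \<beta> * poly_const (Q \<beta> \<gamma>) * poly_monom \<gamma>) \<and>
     (\<forall>\<beta>\<in>multi_indices n d. \<forall>\<gamma>\<in>multi_indices n d.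
        (\<exists>i\<in>{1..n}. \<exists>j\<in>{1..n}. i \<noteq> j \<and> (i, j) \<notin> E \<and>
           Poly_Mapping.lookup \<beta> i + Poly_Mapping.lookup \<gamma> i \<noteq> 0 \<and> Poly_Mapping.lookup \<beta> j + Poly_Mapping.lookup \<gamma> j \<noteq> 0) \<longrightarrow>
        Q \<beta> \<gamma> = 0)}"

end

theory Submission
  imports Defs "HOL-Library.FuncSet"
begin

text \<open>
  A chordal graph has a simplicial vertex \<open>s\<close>. In a sparse Gram matrix, the rows of all monomials
  involving \<open>x\<^sub>s\<close> are supported on monomials in the variables of the clique formed by \<open>s\<close> and its
  neighbours. Eliminating these rows by Schur complements splits off rank one terms supported on
  that clique and leaves a positive semidefinite matrix that has the same sparsity and does not
  involve \<open>s\<close>; by induction on the vertex set the Gram matrix is a sum of rank one matrices, each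
  supported on a clique. Conversely, the squares in the clique polynomials have no degree
  cancellation, so each squared polynomial has degree at most \<open>d\<close>, and the sum of the outer
  products of their coefficient vectors is a sparse Gram matrix.
\<close>

section \<open>Simplicial vertices of chordal graphs\<close>

text \<open>The assumption \<open>a \<in> U\<close> covers the trivial walk, for reflexivity of the
  closure gives no information about \<open>U\<close>.\<close>

lemma rtrancl_Restr_walk:
  assumes "(a, b) \<in> (Restr E U)\<^sup>*" and "a \<in> U"
  shows "\<exists>xs. xs \<noteq> [] \<and> hd xs = a \<and> last xs = b \<and>
    successively (\<lambda>u v. (u, v) \<in> E) xs \<and> set xs \<subseteq> U"
  using assms(1)
proof (induction rule: rtrancl_induct)
  case base
  show ?case using assms(2) by (intro exI[of _ "[a]"]) auto
next
  case (step b c)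
  then obtain xs where "xs \<noteq> []" "hd xs = a" "last xs = b"
    "successively (\<lambda>u v. (u, v) \<in> E) xs" "set xs \<subseteq> U" by blast
  with step(2) show ?case
    by (intro exI[of _ "xs @ [c]"]) (auto simp: successively_append_iff)
qed

lemma successively_conv_nth:
  "successively P xs \<longleftrightarrow> (\<forall>i. Suc i < length xs \<longrightarrow> P (xs ! i) (xs ! Suc i))"
proof (induction P xs rule: successively.induct)
  case (3 P x y xs)
  then show ?case by (auto simp: nth_Cons split: nat.splits)
qed auto

text \<open>A walk of least length will do: a chord or a repeated node would permit a shorter walk
  with the same ends.\<close>

lemma chordless_path:
  assumes "xs \<noteq> []" "hd xs = u" "last xs = v"
    "successively (\<lambda>u v. (u, v) \<in> E) xs" "set xs \<subseteq> U"
  obtains ys where "ys \<noteq> []" "hd ys = u" "last ys = v"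
    "successively (\<lambda>u v. (u, v) \<in> E) ys" "set ys \<subseteq> U" "distinct ys"
    "\<And>i j. i < j \<Longrightarrow> j < length ys \<Longrightarrow> (ys ! i, ys ! j) \<in> E \<Longrightarrow> j = Suc i"
proof -
  define P where "P ys \<longleftrightarrow> ys \<noteq> [] \<and> hd ys = u \<and> last ys = v \<and>
    successively (\<lambda>u v. (u, v) \<in> E) ys \<and> set ys \<subseteq> U" for ys
  have "P xs" using assms by (simp add: P_def)
  then obtain ys where ys: "P ys" and least: "\<And>zs. P zs \<Longrightarrow> length ys \<le> length zs"
    using ex_has_least_nat[of P xs length] by auto
  have nth: "(ys ! i, ys ! Suc i) \<in> E" if "Suc i < length ys" for i
    using ys that by (auto simp: P_def successively_conv_nth)
  have sub: "set (take i ys @ drop j ys) \<subseteq> U" for i j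
    using ys set_take_subset[of i ys] set_drop_subset[of j ys] by (auto simp: P_def)
  have suc: "successively (\<lambda>u v. (u, v) \<in> E) (take i ys)"
    "successively (\<lambda>u v. (u, v) \<in> E) (drop i ys)" for i
    using ys successively_append_iff[of _ "take i ys" "drop i ys"] by (auto simp: P_def)
  \<comment> \<open>The part strictly between positions \<open>i\<close> and \<open>j\<close> is
    replaced by the edge joining them. Nothing is removed if \<open>j = Suc i\<close>, and this is
    the only case that minimality allows.\<close>
  have shortcut: "P (take (Suc i) ys @ drop j ys)"
    if ij: "i < j" "j < length ys" "(ys ! i, ys ! j) \<in> E" for i j
  proof -
    have "last (take (Suc i) ys) = ys ! i"
      using ij by (simp add: take_Suc_conv_app_nth)
    moreover have "hd (drop j ys) = ys ! j" "hd (take (Suc i) ys) = hd ys"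
      using ij by (auto simp: hd_drop_conv_nth)
    ultimately have "hd (take (Suc i) ys) = hd ys"
      "successively (\<lambda>u v. (u, v) \<in> E) (take (Suc i) ys @ drop j ys)"
      using suc ij(3) by (auto simp add: successively_append_iff)
    then show ?thesis
      using ys sub[of "Suc i" j] ij \<open>hd (take (Suc i) ys) = hd ys\<close> unfolding P_def by auto
  qed
  have chord: "j = Suc i" if "i < j" "j < length ys" "(ys ! i, ys ! j) \<in> E" for i j
    using least[OF shortcut[OF that]] that by auto
  have "ys ! i \<noteq> ys ! j" if "i < j" "j < length ys" for i j
  proof
    assume eq: "ys ! i = ys ! j"
    \<comment> \<open>The closed stretch from \<open>i\<close> to \<open>j\<close> is cut out. For
      \<open>i = 0\<close> the remaining walk starts at \<open>ys ! j\<close>, which is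
      \<open>u\<close>; otherwise the predecessor of \<open>ys ! i\<close> is adjacent to
      \<open>ys ! j\<close>, so a shortcut applies.\<close>
    have "P (take i ys @ drop j ys)"
    proof (cases i)
      case 0
      then show ?thesis using ys that suc eq set_drop_subset[of j ys]
        by (auto simp: P_def hd_drop_conv_nth hd_conv_nth)
    next
      case (Suc k)
      then show ?thesis using nth[of k] shortcut[of k j] that eq by simp
    qed
    from least[OF this] that show False by auto
  qed
  then have "distinct ys"
    unfolding distinct_conv_nth by (metis nat_neq_iff)
  with ys chord that show thesis unfolding P_def by blast
qed

text \<open>If \<open>u\<close> and \<open>v\<close> were nonadjacent, a chordless path between them
  with inner nodes in \<open>W\<close>, closed up by \<open>x\<close>, would be a cycle of length at
  least 4 without a chord.\<close>

lemma chordal_common_neighbours_adjacent: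
  assumes "chordal E" "sym E" and "(x, u) \<in> E" "(x, v) \<in> E" "u \<noteq> v" "u \<noteq> x" "v \<noteq> x"
    and W: "\<And>w. w \<in> W \<Longrightarrow> w \<noteq> x \<and> (x, w) \<notin> E"
    and walk: "xs \<noteq> []" "hd xs = u" "last xs = v"
      "successively (\<lambda>u v. (u, v) \<in> E) xs" "set xs \<subseteq> insert u (insert v W)"
  shows "(u, v) \<in> E"
proof (rule ccontr)
  assume nadj: "(u, v) \<notin> E"
  from walk obtain ys where ys: "ys \<noteq> []" "hd ys = u" "last ys = v"
    "successively (\<lambda>u v. (u, v) \<in> E) ys" "set ys \<subseteq> insert u (insert v W)" "distinct ys"
    and chord: "\<And>i j. i < j \<Longrightarrow> j < length ys \<Longrightarrow> (ys ! i, ys ! j) \<in> E \<Longrightarrow> j = Suc i"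
    by (rule chordless_path) blast
  define L where "L = length ys"
  have y0: "ys ! 0 = u" and yL: "ys ! (L - 1) = v"
    using ys by (auto simp: L_def hd_conv_nth last_conv_nth)
  have nth: "(ys ! i, ys ! Suc i) \<in> E" if "Suc i < L" for i
    using ys that by (auto simp: L_def successively_conv_nth)
  have "L \<noteq> 0" using ys by (simp add: L_def)
  have "L \<noteq> 1" using y0 yL \<open>u \<noteq> v\<close> by auto
  have "L \<noteq> 2" using y0 yL nadj nth[of 0] by auto
  with \<open>L \<noteq> 0\<close> \<open>L \<noteq> 1\<close> have L3: "3 \<le> L" by simp
  \<comment> \<open>An inner node differs from both ends, since the path is distinct, so it lies in
    \<open>W\<close>.\<close>
  have xnadj: "(x, ys ! j) \<notin> E" if "0 < j" "j < L - 1" for j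
  proof -
    have "j < length ys" using that by (simp add: L_def)
    then have "ys ! j \<noteq> ys ! 0" "ys ! j \<noteq> ys ! (L - 1)"
      using that ys(1) nth_eq_iff_index_eq[OF ys(6), of j 0] nth_eq_iff_index_eq[OF ys(6), of j "L - 1"]
      by (auto simp: L_def)
    moreover have "ys ! j \<in> insert u (insert v W)"
      using ys(5) that by (auto simp: L_def subset_iff)
    ultimately show ?thesis using W y0 yL by auto
  qed
  \<comment> \<open>Position \<open>Suc k\<close> of the cycle is position \<open>k\<close> of the
    path, and \<open>x\<close> has position 0.\<close>
  let ?c = "x # ys"
  have len: "length ?c = Suc L" by (simp add: L_def)
  have "is_cycle E ?c"
    unfolding is_cycle_def
  proof (intro conjI allI impI)
    show "3 \<le> length ?c" using L3 by (simp add: L_def)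
    show "distinct ?c" using ys W assms by auto
    fix i assume i: "i < length ?c"
    show "(?c ! i, ?c ! (Suc i mod length ?c)) \<in> E"
    proof (cases "i = L")
      case True
      then have "?c ! i = v" "?c ! (Suc i mod length ?c) = x"
        using L3 yL by (auto simp: L_def nth_Cons')
      then show ?thesis using assms(2,4) by (auto dest: symD)
    next
      case False
      with i len have "i < L" by simp
      then have "?c ! (Suc i mod length ?c) = ys ! i" by (simp add: L_def)
      then show ?thesis using y0 assms(3) nth[of "i - 1"] \<open>i < L\<close>
        by (cases i) auto
    qed
  qed
  then have "has_chord E ?c"
    using \<open>chordal E\<close> L3 len unfolding chordal_def by auto
  then obtain i j where "i < Suc L" "j < Suc L" "i \<noteq> j" "j \<noteq> Suc i mod Suc L"
    "i \<noteq> Suc j mod Suc L" "(?c ! i, ?c ! j) \<in> E"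
    unfolding has_chord_def len by blast
  then have "\<exists>i j. i < j \<and> j \<le> L \<and> j \<noteq> Suc i mod Suc L \<and> i \<noteq> Suc j mod Suc L \<and> (?c ! i, ?c ! j) \<in> E"
    using \<open>sym E\<close> by (metis less_Suc_eq_le nat_neq_iff symD)
  then obtain i j where ij: "i < j" "j \<le> L" "j \<noteq> Suc i mod Suc L" "i \<noteq> Suc j mod Suc L"
    "(?c ! i, ?c ! j) \<in> E" by blast
  then have j: "j \<noteq> Suc i" by auto
  \<comment> \<open>A chord starting at \<open>x\<close> would end at an inner node, as positions 1
    and \<open>L\<close> are next to position 0 on the cycle; any other chord would be a chord of
    the path.\<close>
  show False
  proof (cases i)
    case 0
    with ij have "j \<noteq> L" by auto
    then show False using xnadj[of "j - 1"] ij j 0 by (auto simp: nth_Cons')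
  next
    case (Suc k)
    then show False using chord[of k "j - 1"] ij j by (auto simp: L_def nth_Cons')
  qed
qed

text \<open>Placing the simplicial node away from a prescribed \<open>x\<close> is what makes the
  induction on \<open>V\<close> work: it keeps the node found in a smaller set off the separator.
  \<open>E\<close> stays fixed, so chordality does not have to be transferred.\<close>

lemma chordal_simplicial_nonadjacent:
  assumes "finite V" "sym E" "chordal E" "x \<in> V" "z \<in> V" "z \<noteq> x" "(x, z) \<notin> E"
  shows "\<exists>s\<in>V. s \<noteq> x \<and> (x, s) \<notin> E \<and> clique V E {v \<in> V. v = s \<or> (s, v) \<in> E}"
  using assms(1,4-)
proof (induction V arbitrary: x z rule: finite_psubset_induct)
  case (psubset V)
  \<comment> \<open>\<open>W\<close> is the component of \<open>z\<close> in the graph on the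
    non-neighbours \<open>U\<close> of \<open>x\<close>, and \<open>S\<close> is its boundary, which
    separates \<open>W\<close> from \<open>x\<close>.\<close>
  define U where "U = {w \<in> V. w \<noteq> x \<and> (x, w) \<notin> E}"
  define W where "W = {w. (z, w) \<in> (Restr E U)\<^sup>*}"
  define S where "S = {v \<in> V - W. \<exists>w\<in>W. (v, w) \<in> E}"
  have zU: "z \<in> U" using psubset by (auto simp: U_def)
  have zW: "z \<in> W" by (simp add: W_def)
  have WU: "W \<subseteq> U"
  proof
    fix w assume "w \<in> W"
    then have "(z, w) \<in> (Restr E U)\<^sup>*" by (simp add: W_def)
    then show "w \<in> U" using zU by (cases rule: rtrancl.cases) auto
  qed
  have closed: "v \<in> W" if "w \<in> W" "(w, v) \<in> E" "v \<in> U" for v w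
    using that WU unfolding W_def by (auto intro: rtrancl_into_rtrancl)
  \<comment> \<open>A boundary node that is not a neighbour of \<open>x\<close> would belong to
    \<open>U\<close> and be absorbed by the component.\<close>
  have Sx: "(x, v) \<in> E \<and> v \<noteq> x" if "v \<in> S" for v
  proof -
    from that obtain w where w: "w \<in> W" "(v, w) \<in> E" "v \<in> V" "v \<notin> W" by (auto simp: S_def)
    then have "v \<notin> U" using closed[of w v] \<open>sym E\<close> by (auto dest: symD)
    moreover have "v \<noteq> x" using w WU by (auto simp: U_def)
    ultimately show ?thesis using w by (auto simp: U_def)
  qed
  have "sym ((Restr E U)\<^sup>*)"
    using \<open>sym E\<close> by (intro sym_rtrancl) (auto simp: sym_def)
  have Sclique: "(u, v) \<in> E" if u: "u \<in> S" and v: "v \<in> S" and "u \<noteq> v" for u v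
  proof -
    from u v obtain a b where ab: "a \<in> W" "(u, a) \<in> E" "b \<in> W" "(v, b) \<in> E" by (auto simp: S_def)
    have "(a, b) \<in> (Restr E U)\<^sup>*"
      using ab(1,3) \<open>sym ((Restr E U)\<^sup>*)\<close> unfolding W_def by (auto dest: symD intro: rtrancl_trans)
    moreover have "Restr E U `` W \<subseteq> W" using closed by auto
    \<comment> \<open>A path in \<open>U\<close> that starts in the component \<open>W\<close> never
      leaves it, so the walk obtained next has all its nodes in \<open>W\<close>.\<close>
    ultimately have "(a, b) \<in> (Restr E W)\<^sup>*"
    proof (induction rule: rtrancl_induct)
      case (step y w)
      have "(z, y) \<in> (Restr E U)\<^sup>*" "(z, w) \<in> (Restr E U)\<^sup>*" 
        using ab(1) step(1,2) unfolding W_def by (auto intro: rtrancl_trans rtrancl_into_rtrancl)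
      then have "(y, w) \<in> Restr E W" using step(2) by (auto simp: W_def)
      with step show ?case by (auto intro: rtrancl_into_rtrancl)
    qed simp
    from rtrancl_Restr_walk[OF this ab(1)] obtain xs where xs: "xs \<noteq> []" "hd xs = a" "last xs = b"
      "successively (\<lambda>u v. (u, v) \<in> E) xs" "set xs \<subseteq> W" by blast
    show ?thesis
    proof (rule chordal_common_neighbours_adjacent[of E x u v W "u # xs @ [v]"])
      show "successively (\<lambda>u v. (u, v) \<in> E) (u # xs @ [v])"
        using xs ab \<open>sym E\<close>
        by (cases xs) (auto simp: successively_append_iff successively_Cons hd_append dest: symD)
    qed (use assms(2,3) Sx[OF u] Sx[OF v] \<open>u \<noteq> v\<close> WU xs in \<open>auto simp: U_def\<close>)
  qed
  \<comment> \<open>No neighbour in \<open>V\<close> of a node of \<open>W\<close> lies outside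
    \<open>W \<union> S\<close>, so for nodes of \<open>W\<close> simpliciality within
    \<open>W \<union> S\<close> carries over to \<open>V\<close>.\<close>
  have nbhd: "{v \<in> V. v = s \<or> (s, v) \<in> E} \<subseteq> W \<union> S" if "s \<in> W" for s
    using that \<open>sym E\<close> by (auto simp: S_def dest: symD)
  have WSV: "W \<union> S \<subseteq> V" using WU by (auto simp: U_def S_def)
  have sub: "W \<union> S \<subset> V"
    using WSV Sx WU \<open>x \<in> V\<close> by (auto simp: U_def)
  have U_nonadj: "s \<in> V \<and> s \<noteq> x \<and> (x, s) \<notin> E" if "s \<in> W" for s
    using that WU by (auto simp: U_def)
  show ?case
  proof (cases "clique V E (W \<union> S)")
    case True
    with nbhd[OF zW] have "clique V E {v \<in> V. v = z \<or> (z, v) \<in> E}"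
      unfolding clique_def by blast
    with U_nonadj[OF zW] show ?thesis by blast
  next
    case False
    then obtain a b where ab: "a \<in> W \<union> S" "b \<in> W \<union> S" "a \<noteq> b" "(a, b) \<notin> E"
      using WSV unfolding clique_def by blast
    \<comment> \<open>Such a \<open>y\<close> takes the role of \<open>x\<close> in the induction
      hypothesis: the node returned is different from and nonadjacent to \<open>y\<close>, hence not
      in \<open>S\<close>.\<close>
    have "\<exists>y\<in>W \<union> S. \<exists>y'\<in>W \<union> S. y' \<noteq> y \<and> (y, y') \<notin> E \<and> (\<forall>v\<in>S. v = y \<or> (y, v) \<in> E)"
    proof (cases "\<exists>y\<in>S. \<exists>w\<in>W. (y, w) \<notin> E")
      case True
      then obtain y w where "y \<in> S" "w \<in> W" "(y, w) \<notin> E" by blast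
      moreover have "w \<noteq> y" using \<open>y \<in> S\<close> \<open>w \<in> W\<close> by (auto simp: S_def)
      moreover have "\<forall>v\<in>S. v = y \<or> (y, v) \<in> E" using Sclique \<open>y \<in> S\<close> by blast
      ultimately show ?thesis by blast
    next
      case False
      then have "(v, w) \<in> E \<and> (w, v) \<in> E" if "v \<in> S" "w \<in> W" for v w
        using that \<open>sym E\<close> by (auto dest: symD)
      \<comment> \<open>When \<open>S\<close> is completely joined to \<open>W\<close>, a
        nonadjacent pair must lie inside \<open>W\<close>, because \<open>S\<close> is a
        clique.\<close>
      then have "a \<in> W" "b \<in> W" using ab Sclique by blast+
      moreover have "\<forall>v\<in>S. v = a \<or> (a, v) \<in> E"
        using False \<open>a \<in> W\<close> \<open>sym E\<close> by (auto dest: symD)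
      ultimately have "b \<noteq> a \<and> (a, b) \<notin> E \<and> (\<forall>v\<in>S. v = a \<or> (a, v) \<in> E)"
        using ab by auto
      with ab(1,2) show ?thesis by (blast intro: bexI[of _ a])
    qed
    then obtain y y' where y: "y \<in> W \<union> S" "y' \<in> W \<union> S" "y' \<noteq> y" "(y, y') \<notin> E"
      and yS: "\<forall>v\<in>S. v = y \<or> (y, v) \<in> E" by blast
    from psubset.IH[OF sub y] obtain s where s: "s \<in> W \<union> S" "s \<noteq> y" "(y, s) \<notin> E"
      "clique (W \<union> S) E {v \<in> W \<union> S. v = s \<or> (s, v) \<in> E}" by blast
    then have "s \<in> W" using yS by auto
    from nbhd[OF this] s(4) have "clique V E {v \<in> V. v = s \<or> (s, v) \<in> E}"
      unfolding clique_def by blast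
    with U_nonadj[OF \<open>s \<in> W\<close>] show ?thesis by blast
  qed
qed

lemma chordal_ex_simplicial:
  assumes "finite V" "sym E" "chordal E" "V \<noteq> {}"
  obtains s where "s \<in> V" "clique V E {v \<in> V. v = s \<or> (s, v) \<in> E}"
proof (cases "clique V E V")
  case True
  then have "clique V E {v \<in> V. v = s \<or> (s, v) \<in> E}" for s
    unfolding clique_def by blast
  with \<open>V \<noteq> {}\<close> that show thesis by blast
next
  case False
  then obtain x z where "x \<in> V" "z \<in> V" "z \<noteq> x" "(x, z) \<notin> E" unfolding clique_def by blast
  with chordal_simplicial_nonadjacent[OF assms(1-3)] that show thesis by blast
qed

section \<open>Schur complements\<close>

lemma mult_if_zero:
  fixes y :: real
  shows "(if b then x else 0) * y = (if b then x * y else 0)"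
    and "y * (if b then x else 0) = (if b then y * x else 0)"
  by simp_all

definition quad_form :: "'i set \<Rightarrow> ('i \<Rightarrow> 'i \<Rightarrow> real) \<Rightarrow> ('i \<Rightarrow> real) \<Rightarrow> real" where
  "quad_form I Q v = (\<Sum>\<beta>\<in>I. \<Sum>\<gamma>\<in>I. v \<beta> * Q \<beta> \<gamma> * v \<gamma>)"

text \<open>Along the coordinate direction \<open>a\<close> the form is a quadratic polynomial in
  \<open>c\<close>. Later \<open>c\<close> is chosen so as to reach a negative value or the
  minimum.\<close>

lemma quad_form_add_unit:
  assumes "finite I" "a \<in> I" and sym: "\<And>\<beta> \<gamma>. \<beta> \<in> I \<Longrightarrow> \<gamma> \<in> I \<Longrightarrow> Q \<beta> \<gamma> = Q \<gamma> \<beta>"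
  shows "quad_form I Q (\<lambda>\<beta>. v \<beta> + (if \<beta> = a then c else 0)) =
    quad_form I Q v + 2 * c * (\<Sum>\<gamma>\<in>I. Q a \<gamma> * v \<gamma>) + c\<^sup>2 * Q a a"
proof -
  let ?e = "\<lambda>\<beta>. if \<beta> = a then c else 0"
  have "quad_form I Q (\<lambda>\<beta>. v \<beta> + ?e \<beta>) =
    quad_form I Q v + (\<Sum>\<beta>\<in>I. \<Sum>\<gamma>\<in>I. v \<beta> * Q \<beta> \<gamma> * ?e \<gamma>) +
    (\<Sum>\<beta>\<in>I. \<Sum>\<gamma>\<in>I. ?e \<beta> * Q \<beta> \<gamma> * v \<gamma>) + (\<Sum>\<beta>\<in>I. \<Sum>\<gamma>\<in>I. ?e \<beta> * Q \<beta> \<gamma> * ?e \<gamma>)"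
    by (simp add: quad_form_def distrib_left distrib_right sum.distrib)
  also have "(\<Sum>\<beta>\<in>I. \<Sum>\<gamma>\<in>I. v \<beta> * Q \<beta> \<gamma> * ?e \<gamma>) = c * (\<Sum>\<gamma>\<in>I. Q a \<gamma> * v \<gamma>)"
  proof -
    have "(\<Sum>\<beta>\<in>I. \<Sum>\<gamma>\<in>I. v \<beta> * Q \<beta> \<gamma> * ?e \<gamma>) = (\<Sum>\<beta>\<in>I. v \<beta> * Q \<beta> a * c)"
      using assms(1,2) by (simp add: mult_if_zero sum.delta)
    also have "\<dots> = (\<Sum>\<beta>\<in>I. c * (Q a \<beta> * v \<beta>))"
      using sym[OF _ assms(2)] by (intro sum.cong) auto
    finally show ?thesis by (simp add: sum_distrib_left)
  qed
  also have "(\<Sum>\<beta>\<in>I. \<Sum>\<gamma>\<in>I. ?e \<beta> * Q \<beta> \<gamma> * v \<gamma>) = c * (\<Sum>\<gamma>\<in>I. Q a \<gamma> * v \<gamma>)"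
    using assms(1,2) by (subst sum.swap) (simp add: mult_if_zero sum.delta sum_distrib_left mult.assoc)
  also have "(\<Sum>\<beta>\<in>I. \<Sum>\<gamma>\<in>I. ?e \<beta> * Q \<beta> \<gamma> * ?e \<gamma>) = c\<^sup>2 * Q a a"
    using assms(1,2) by (simp add: mult_if_zero sum.delta power2_eq_square)
  finally show ?thesis by simp
qed

lemma quad_form_unit:
  assumes "finite I" "a \<in> I"
  shows "quad_form I Q (\<lambda>\<beta>. if \<beta> = a then 1 else 0) = Q a a"
  using assms by (simp add: quad_form_def mult_if_zero sum.delta)

lemma quad_form_rank_one:
  "quad_form I (\<lambda>\<beta> \<gamma>. Q \<beta> \<gamma> - v \<beta> * v \<gamma>) w = quad_form I Q w - (\<Sum>\<beta>\<in>I. v \<beta> * w \<beta>)\<^sup>2"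
  by (simp add: quad_form_def power2_eq_square sum_product sum_subtractf algebra_simps)

lemma psd_on_quad_form:
  "psd_on I Q \<longleftrightarrow> (\<forall>\<beta>\<in>I. \<forall>\<gamma>\<in>I. Q \<beta> \<gamma> = Q \<gamma> \<beta>) \<and> (\<forall>v. 0 \<le> quad_form I Q v)"
  by (simp add: psd_on_def quad_form_def)

lemma psd_on_diag:
  assumes "finite I" "psd_on I Q" "a \<in> I"
  shows "0 \<le> Q a a"
  using assms quad_form_unit[of I a Q] unfolding psd_on_quad_form by metis

text \<open>With \<open>Q a a = 0\<close> the form is affine in the coordinate \<open>a\<close>, so
  a nonzero slope would make it negative somewhere.\<close>

lemma psd_on_diag_zero:
  assumes "finite I" "psd_on I Q" "a \<in> I" "Q a a = 0" "\<gamma> \<in> I"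
  shows "Q a \<gamma> = 0"
proof (rule ccontr)
  assume nz: "Q a \<gamma> \<noteq> 0"
  \<comment> \<open>This solves
    \<open>Q \<gamma> \<gamma> + 2 * c * Q a \<gamma> = -1\<close>.\<close>
  define c where "c = - (Q \<gamma> \<gamma> + 1) / (2 * Q a \<gamma>)"
  have "quad_form I Q (\<lambda>\<beta>. (if \<beta> = \<gamma> then 1 else 0) + (if \<beta> = a then c else 0)) =
    Q \<gamma> \<gamma> + 2 * c * (\<Sum>\<delta>\<in>I. Q a \<delta> * (if \<delta> = \<gamma> then 1 else 0))"
    using assms by (subst quad_form_add_unit) (auto simp: quad_form_unit psd_on_quad_form)
  also have "\<dots> = Q \<gamma> \<gamma> + 2 * c * Q a \<gamma>"
    using assms by (simp add: mult_if_zero sum.delta)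
  also have "\<dots> = -1" using nz by (simp add: c_def field_simps)
  finally show False using assms(2) unfolding psd_on_quad_form
    by (metis neg_0_le_iff_le not_one_le_zero)
qed

text \<open>If \<open>Q a a = 0\<close>, then the row of \<open>a\<close> vanishes and the division by zero makes the subtracted
  term vanish as well.\<close>

lemma psd_on_schur_complement:
  fixes Q :: "'i \<Rightarrow> 'i \<Rightarrow> real"
  assumes "finite I" "psd_on I Q" "a \<in> I"
  defines "v \<equiv> \<lambda>\<gamma>. Q a \<gamma> / sqrt (Q a a)"
  shows "psd_on I (\<lambda>\<beta> \<gamma>. Q \<beta> \<gamma> - v \<beta> * v \<gamma>)"
    and "\<gamma> \<in> I \<Longrightarrow> Q a \<gamma> - v a * v \<gamma> = 0"
proof -
  have nonneg: "0 \<le> Q a a" using assms by (intro psd_on_diag) auto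
  show "Q a \<gamma> - v a * v \<gamma> = 0" if "\<gamma> \<in> I"
    using psd_on_diag_zero[OF assms(1-3) _ that] nonneg
    by (cases "Q a a = 0") (auto simp: v_def)
  have "0 \<le> quad_form I (\<lambda>\<beta> \<gamma>. Q \<beta> \<gamma> - v \<beta> * v \<gamma>) w" for w
  proof (cases "Q a a = 0")
    case True
    then show ?thesis using assms by (simp add: v_def psd_on_quad_form)
  next
    case False
    define s where "s = (\<Sum>\<gamma>\<in>I. Q a \<gamma> * w \<gamma>)"
    \<comment> \<open>The added coefficient minimises the form in direction \<open>a\<close>; the
      minimum is the form of the Schur complement at \<open>w\<close>.\<close>
    have "0 \<le> quad_form I Q (\<lambda>\<beta>. w \<beta> + (if \<beta> = a then - s / Q a a else 0))"
      using assms(2) by (simp add: psd_on_quad_form)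
    also have "\<dots> = quad_form I Q w + 2 * (- s / Q a a) * s + (- s / Q a a)\<^sup>2 * Q a a"
      using assms unfolding s_def by (intro quad_form_add_unit) (auto simp: psd_on_quad_form)
    also have "\<dots> = quad_form I Q w - s\<^sup>2 / Q a a"
      using False by (simp add: field_simps power2_eq_square)
    also have "s\<^sup>2 / Q a a = (s / sqrt (Q a a))\<^sup>2"
      using nonneg by (simp add: power_divide)
    also have "s / sqrt (Q a a) = (\<Sum>\<gamma>\<in>I. v \<gamma> * w \<gamma>)"
      by (simp add: s_def v_def sum_divide_distrib)
    finally show ?thesis by (simp add: quad_form_rank_one)
  qed
  then show "psd_on I (\<lambda>\<beta> \<gamma>. Q \<beta> \<gamma> - v \<beta> * v \<gamma>)"
    using assms(2) by (auto simp: psd_on_quad_form)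
qed

lemma sum_list_map_eq_0:
  fixes f :: "'a \<Rightarrow> 'b::monoid_add"
  shows "(\<And>x. x \<in> set xs \<Longrightarrow> f x = 0) \<Longrightarrow> (\<Sum>x\<leftarrow>xs. f x) = 0"
  by (induction xs) auto

text \<open>One Schur complement is taken for each index in \<open>A\<close>. The subtracted vectors
  are supported on \<open>K\<close>, so outside \<open>K\<close> the remaining rows still agree with
  those of \<open>Q\<close>, and the next vector is supported on \<open>K\<close> again.\<close>

lemma psd_on_eliminate:
  assumes "finite I" "psd_on I Q" "finite A" "A \<subseteq> I"
    and "\<forall>\<beta>\<in>A. \<forall>\<gamma>\<in>I. Q \<beta> \<gamma> \<noteq> 0 \<longrightarrow> \<gamma> \<in> K"
  shows "\<exists>Q' vs. psd_on I Q' \<and>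
    (\<forall>\<beta>\<in>I. \<forall>\<gamma>\<in>I. Q \<beta> \<gamma> = Q' \<beta> \<gamma> + (\<Sum>v\<leftarrow>vs. v \<beta> * v \<gamma>)) \<and>
    (\<forall>v\<in>set vs. \<forall>\<beta>\<in>I. v \<beta> \<noteq> 0 \<longrightarrow> \<beta> \<in> K) \<and> (\<forall>\<beta>\<in>A. \<forall>\<gamma>\<in>I. Q' \<beta> \<gamma> = 0)"
  using assms(3-)
proof (induction A rule: finite_induct)
  case empty
  show ?case using assms(2) by (intro exI[of _ Q] exI[of _ "[]"]) simp
next
  case (insert a A)
  have "A \<subseteq> I" using insert.prems(1) by simp
  then obtain Q' vs where Q': "psd_on I Q'"
    "\<forall>\<beta>\<in>I. \<forall>\<gamma>\<in>I. Q \<beta> \<gamma> = Q' \<beta> \<gamma> + (\<Sum>v\<leftarrow>vs. v \<beta> * v \<gamma>)"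
    "\<forall>v\<in>set vs. \<forall>\<beta>\<in>I. v \<beta> \<noteq> 0 \<longrightarrow> \<beta> \<in> K"
    "\<forall>\<beta>\<in>A. \<forall>\<gamma>\<in>I. Q' \<beta> \<gamma> = 0"
    using insert.IH insert.prems(2) by blast
  have a: "a \<in> I" using insert.prems by simp
  define w where "w \<gamma> = Q' a \<gamma> / sqrt (Q' a a)" for \<gamma>
  note schur = psd_on_schur_complement[OF assms(1) Q'(1) a, folded w_def]
  have wK: "\<gamma> \<in> K" if "\<gamma> \<in> I" "w \<gamma> \<noteq> 0" for \<gamma>
  proof (rule ccontr)
    assume "\<gamma> \<notin> K"
    then have "v a * v \<gamma> = 0" if "v \<in> set vs" for v using Q'(3) that \<open>\<gamma> \<in> I\<close> by auto
    then have "(\<Sum>v\<leftarrow>vs. v a * v \<gamma>) = 0" by (rule sum_list_map_eq_0)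
    then have "Q a \<gamma> = Q' a \<gamma>" using Q'(2) a that(1) by simp
    then show False using insert.prems(2) \<open>\<gamma> \<notin> K\<close> that by (auto simp: w_def)
  qed
  \<comment> \<open>By symmetry the eliminated rows are also zero columns, so \<open>w\<close>
    vanishes on \<open>A\<close> and the new subtraction does not refill them.\<close>
  have wA: "w \<beta> = 0" if "\<beta> \<in> A" for \<beta>
  proof -
    have "Q' a \<beta> = Q' \<beta> a" using Q'(1) a that \<open>A \<subseteq> I\<close> by (auto simp: psd_on_def)
    then show ?thesis using Q'(4) that a by (simp add: w_def)
  qed
  have "Q' \<beta> \<gamma> - w \<beta> * w \<gamma> = 0" if "\<beta> \<in> insert a A" "\<gamma> \<in> I" for \<beta> \<gamma>
    using that schur(2) wA Q'(4) by (cases "\<beta> = a") auto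
  then show ?case
    using schur(1) Q'(2,3) wK
    by (intro exI[of _ "\<lambda>\<beta> \<gamma>. Q' \<beta> \<gamma> - w \<beta> * w \<gamma>"] exI[of _ "w # vs"]) auto
qed

section \<open>Polynomials\<close>

text \<open>A multi-index in this set is determined by its values on \<open>{1..n}\<close>, each of
  which is at most \<open>d\<close>.\<close>

lemma finite_multi_indices: "finite (multi_indices n d)"
proof -
  have "inj_on (\<lambda>\<alpha>. restrict (Poly_Mapping.lookup \<alpha>) {1..n}) (multi_indices n d)"
  proof (rule inj_onI, rule poly_mapping_eqI)
    fix \<alpha> \<beta> :: multi_index and i
    assume \<alpha>\<beta>: "\<alpha> \<in> multi_indices n d" "\<beta> \<in> multi_indices n d"
      and eq: "restrict (Poly_Mapping.lookup \<alpha>) {1..n} = restrict (Poly_Mapping.lookup \<beta>) {1..n}"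
    show "Poly_Mapping.lookup \<alpha> i = Poly_Mapping.lookup \<beta> i"
    proof (cases "i \<in> {1..n}")
      case True
      then show ?thesis using fun_cong[OF eq, of i] by simp
    next
      case False
      then have "i \<notin> Poly_Mapping.keys \<alpha>" "i \<notin> Poly_Mapping.keys \<beta>"
        using \<alpha>\<beta> by (auto simp: multi_indices_def)
      then show ?thesis by (simp add: in_keys_iff)
    qed
  qed
  moreover have "(\<lambda>\<alpha>. restrict (Poly_Mapping.lookup \<alpha>) {1..n}) ` multi_indices n d \<subseteq> {1..n} \<rightarrow>\<^sub>E {..d}"
  proof -
    have "Poly_Mapping.lookup \<alpha> i \<le> d" if "\<alpha> \<in> multi_indices n d" "i \<in> {1..n}" for \<alpha> i
      using that member_le_sum[of i "{1..n}" "Poly_Mapping.lookup \<alpha>"]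
      by (auto simp: multi_indices_def)
    then show ?thesis by auto
  qed
  ultimately show ?thesis
    by (rule inj_on_finite) (intro finite_PiE, auto)
qed

lemma poly_mapping_sum_single:
  fixes p :: "'a \<Rightarrow>\<^sub>0 'b::comm_monoid_add"
  assumes "finite I" "Poly_Mapping.keys p \<subseteq> I"
  shows "p = (\<Sum>\<alpha>\<in>I. Poly_Mapping.single \<alpha> (Poly_Mapping.lookup p \<alpha>))"
proof (rule poly_mapping_eqI)
  fix k
  have "(\<Sum>\<alpha>\<in>I. Poly_Mapping.lookup (Poly_Mapping.single \<alpha> (Poly_Mapping.lookup p \<alpha>)) k) =
    (\<Sum>\<alpha>\<in>I. if \<alpha> = k then Poly_Mapping.lookup p k else 0)"
    by (intro sum.cong) (auto simp: lookup_single when_def)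
  also have "\<dots> = Poly_Mapping.lookup p k"
    using assms by (auto simp: sum.delta in_keys_iff)
  finally show "Poly_Mapping.lookup p k =
      Poly_Mapping.lookup (\<Sum>\<alpha>\<in>I. Poly_Mapping.single \<alpha> (Poly_Mapping.lookup p \<alpha>)) k"
    by (simp add: lookup_sum)
qed

lemma square_sum_single:
  fixes v :: "multi_index \<Rightarrow> real"
  shows "(\<Sum>\<alpha>\<in>I. Poly_Mapping.single \<alpha> (v \<alpha>))\<^sup>2 =
    (\<Sum>\<beta>\<in>I. \<Sum>\<gamma>\<in>I. Poly_Mapping.single (\<beta> + \<gamma>) (v \<beta> * v \<gamma>))"
  by (simp add: power2_eq_square sum_product mult_single)

text \<open>This brings Gram expansions to the same normal form as squares, so that the two can be
  matched entry by entry.\<close>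

lemma gram_single:
  "(\<Sum>\<beta>\<in>I. \<Sum>\<gamma>\<in>I. poly_monom \<beta> * poly_const (Q \<beta> \<gamma>) * poly_monom \<gamma>) =
    (\<Sum>\<beta>\<in>I. \<Sum>\<gamma>\<in>I. Poly_Mapping.single (\<beta> + \<gamma>) (Q \<beta> \<gamma>))"
  by (simp add: poly_monom_def poly_const_def mult_single)

lemma single_sum_list:
  "(\<Sum>x\<leftarrow>xs. Poly_Mapping.single k (f x)) = Poly_Mapping.single k (\<Sum>x\<leftarrow>xs. f x)"
  by (induction xs) (simp_all add: single_add)

lemma sum_sum_list_swap:
  "(\<Sum>x\<leftarrow>xs. \<Sum>i\<in>I. f x i) = (\<Sum>i\<in>I. \<Sum>x\<leftarrow>xs. (f x i :: 'a::comm_monoid_add))"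
  by (induction xs) (simp_all add: sum.distrib)

text \<open>The inner list sum is an entry of the sum of the outer products of the coefficient
  vectors, which is thus a Gram matrix of the sum of squares. Both implications of the theorem use
  this identity.\<close>

lemma sum_list_squares_single:
  fixes vs :: "(multi_index \<Rightarrow> real) list"
  shows "(\<Sum>v\<leftarrow>vs. (\<Sum>\<alpha>\<in>I. Poly_Mapping.single \<alpha> (v \<alpha>))\<^sup>2) =
    (\<Sum>\<beta>\<in>I. \<Sum>\<gamma>\<in>I. Poly_Mapping.single (\<beta> + \<gamma>) (\<Sum>v\<leftarrow>vs. v \<beta> * v \<gamma>))"
  by (simp add: square_sum_single sum_sum_list_swap single_sum_list)

lemma lookup_sum_list:
  "Poly_Mapping.lookup (\<Sum>x\<leftarrow>xs. f x) k = (\<Sum>x\<leftarrow>xs. Poly_Mapping.lookup (f x) k)"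
  by (induction xs) (simp_all add: lookup_add)

section \<open>Polynomials in a subset of the variables, and degrees of sums of squares\<close>

lemma polys_in_zero: "0 \<in> polys_in S"
  by (simp add: polys_in_def)

lemma polys_in_add: "p \<in> polys_in S \<Longrightarrow> q \<in> polys_in S \<Longrightarrow> p + q \<in> polys_in S"
  using keys_add[of p q] by (auto simp: polys_in_def)

lemma polys_in_mult: 
  assumes "p \<in> polys_in S" "q \<in> polys_in S" shows "p * q \<in> polys_in S"
  unfolding polys_in_def
proof (clarify)
  fix \<alpha> i assume "\<alpha> \<in> Poly_Mapping.keys (p * q)" "i \<in> Poly_Mapping.keys \<alpha>"
  then obtain a b where "\<alpha> = a + b" "a \<in> Poly_Mapping.keys p" "b \<in> Poly_Mapping.keys q"
    using keys_mult[of p q] by blast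
  then show "i \<in> S" using assms \<open>i \<in> _\<close> keys_add[of a b]
    unfolding polys_in_def by blast
qed

text \<open>This makes \<open>poly_subst_clique_vars_surj\<close> applicable to a summand of which
  only \<open>sos_in\<close> is known.\<close>

lemma polys_in_sos:
  assumes "sos_in S p" shows "p \<in> polys_in S"
proof -
  from assms obtain qs where "set qs \<subseteq> polys_in S" and p: "p = (\<Sum>q\<leftarrow>qs. q ^ 2)"
    by (auto simp: sos_in_def)
  then show ?thesis unfolding p
    by (induction qs) (auto simp: polys_in_zero power2_eq_square intro: polys_in_add polys_in_mult)
qed

text \<open>A maximal exponent with respect to the graded lexicographic order appears in the sum of
  squares with a sum of squares of reals as its coefficient, so it cannot cancel.\<close>

lemma degree_sum_squares:
  fixes deg :: "multi_index \<Rightarrow> nat"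
  assumes add: "\<And>\<alpha> \<beta>. deg (\<alpha> + \<beta>) = deg \<alpha> + deg \<beta>"
    and le: "\<And>\<alpha>. \<alpha> \<in> Poly_Mapping.keys (\<Sum>q\<leftarrow>qs. q ^ 2 :: real_mpoly) \<Longrightarrow> deg \<alpha> \<le> 2 * d"
    and q: "q \<in> set qs" "\<alpha> \<in> Poly_Mapping.keys q"
  shows "deg \<alpha> \<le> d"
proof -
  define K where "K = (\<Union>q\<in>set qs. Poly_Mapping.keys q)"
  have fin: "finite K" and \<alpha>: "\<alpha> \<in> K" using q by (auto simp: K_def)
  \<comment> \<open>\<open>M\<close> collects the exponents of largest degree; \<open>m\<close> is
    its greatest element in the linear order on multi-indices, which is strictly monotone under
    addition.\<close>
  define M where "M = {\<beta> \<in> K. deg \<beta> = Max (deg ` K)}"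
  have "Max (deg ` K) \<in> deg ` K" using fin \<alpha> by (intro Max_in) auto
  then have M: "finite M" "M \<noteq> {}" using fin by (auto simp: M_def)
  define m where "m = Max M"
  have "m \<in> M" using M by (simp add: m_def)
  then have m: "m \<in> K" "deg m = Max (deg ` K)" by (auto simp: M_def)
  have deg_le: "deg \<beta> \<le> deg m" if "\<beta> \<in> K" for \<beta> using that fin m by simp
  \<comment> \<open>A summand of smaller degree would force the other above the maximal degree.
    Among exponents of equal degree the same argument applies to the order.\<close>
  have split: "a = m \<and> b = m" if "a \<in> K" "b \<in> K" "a + b = m + m" for a b
  proof -
    have "deg a + deg b = deg m + deg m" using add that by metis
    moreover have "deg a \<le> deg m" "deg b \<le> deg m" using deg_le that by auto
    ultimately have "deg a = deg m" "deg b = deg m" by linarith+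
    then have "a \<in> M" "b \<in> M" using that m by (auto simp: M_def)
    then have "a \<le> m" "b \<le> m" using M by (auto simp: m_def)
    then have "\<not> a < m" "\<not> b < m"
      using add_less_le_mono[of a m b m] add_le_less_mono[of a m b m] that(3) by (metis order_less_irrefl)+
    with \<open>a \<le> m\<close> \<open>b \<le> m\<close> show ?thesis by (metis le_neq_trans)
  qed
  have coeff: "Poly_Mapping.lookup (q ^ 2) (m + m) = (Poly_Mapping.lookup q m)\<^sup>2" if "q \<in> set qs" for q
  proof -
    have "Poly_Mapping.keys q \<subseteq> K" using that by (auto simp: K_def)
    then have "q ^ 2 = (\<Sum>\<beta>\<in>K. \<Sum>\<gamma>\<in>K. Poly_Mapping.single (\<beta> + \<gamma>) (Poly_Mapping.lookup q \<beta> * Poly_Mapping.lookup q \<gamma>))"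
      using poly_mapping_sum_single[OF fin, of q, symmetric]
        square_sum_single[of "Poly_Mapping.lookup q" K] by simp
    then have "Poly_Mapping.lookup (q ^ 2) (m + m) =
      (\<Sum>\<beta>\<in>K. \<Sum>\<gamma>\<in>K. (Poly_Mapping.lookup q \<beta> * Poly_Mapping.lookup q \<gamma> when \<beta> + \<gamma> = m + m))"
      by (simp add: lookup_sum lookup_single)
    also have "\<dots> = (\<Sum>\<beta>\<in>K. \<Sum>\<gamma>\<in>K. if \<gamma> = m then (if \<beta> = m then (Poly_Mapping.lookup q m)\<^sup>2 else 0) else 0)"
    proof (intro sum.cong refl)
      fix \<beta> \<gamma> assume K: "\<beta> \<in> K" "\<gamma> \<in> K"
      show "(Poly_Mapping.lookup q \<beta> * Poly_Mapping.lookup q \<gamma> when \<beta> + \<gamma> = m + m) =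
        (if \<gamma> = m then (if \<beta> = m then (Poly_Mapping.lookup q m)\<^sup>2 else 0) else 0)"
      proof (cases "\<beta> = m \<and> \<gamma> = m")
        case True
        then show ?thesis by (simp add: power2_eq_square)
      next
        case False
        with split[OF K] have "\<beta> + \<gamma> \<noteq> m + m" by blast
        with False show ?thesis by (simp only: when_def if_False) simp
      qed
    qed
    also have "\<dots> = (Poly_Mapping.lookup q m)\<^sup>2"
      using fin m(1) by (simp add: sum.delta)
    finally show ?thesis .
  qed
  obtain q' where q': "q' \<in> set qs" "Poly_Mapping.lookup q' m \<noteq> 0"
    using m(1) by (auto simp: K_def in_keys_iff)
  have "Poly_Mapping.lookup (\<Sum>q\<leftarrow>qs. q ^ 2) (m + m) = (\<Sum>q\<leftarrow>qs. (Poly_Mapping.lookup q m)\<^sup>2)"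
    using coeff by (simp add: lookup_sum_list cong: map_cong)
  moreover have "(Poly_Mapping.lookup q' m)\<^sup>2 \<le> (\<Sum>q\<leftarrow>qs. (Poly_Mapping.lookup q m)\<^sup>2)"
    using q' by (intro member_le_sum_list) auto
  ultimately have "m + m \<in> Poly_Mapping.keys (\<Sum>q\<leftarrow>qs. q ^ 2)"
    using q' by (auto simp: in_keys_iff)
  from le[OF this] have "deg m \<le> d" by (simp add: add)
  with deg_le[OF \<alpha>] show ?thesis by simp
qed

text \<open>With the total degree in the first \<open>n\<close> variables for \<open>deg\<close>,
  the preceding lemma shows that the coefficient vectors of the squares can index a Gram matrix over
  \<open>multi_indices n d\<close>.\<close>

lemma multi_indices_degree_sum_squares:
  assumes "(\<Sum>q\<leftarrow>qs. q ^ 2) \<in> polys_upto n (2 * d)" "set qs \<subseteq> polys_in {1..n}" "q \<in> set qs"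
  shows "Poly_Mapping.keys q \<subseteq> multi_indices n d"
proof
  fix \<alpha> assume \<alpha>: "\<alpha> \<in> Poly_Mapping.keys q"
  have "(\<Sum>i=1..n. Poly_Mapping.lookup \<alpha> i) \<le> d"
    by (rule degree_sum_squares[OF _ _ assms(3) \<alpha>])
      (use assms(1) in \<open>auto simp: lookup_add sum.distrib polys_upto_def multi_indices_def\<close>)
  with \<alpha> assms show "\<alpha> \<in> multi_indices n d"
    by (auto simp: multi_indices_def polys_in_def)
qed

section \<open>Substitution of the clique variables\<close>

lemma poly_subst_zero: "poly_subst 0 f = 0"
  by (simp add: poly_subst_def)

text \<open>Additivity of substitution requires the sums for both summands and for their total to
  range over a common index set.\<close>

lemma poly_subst_superset:
  assumes "finite I" "Poly_Mapping.keys p \<subseteq> I"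
  shows "poly_subst p f = (\<Sum>\<alpha>\<in>I. poly_const (Poly_Mapping.lookup p \<alpha>) *
    (\<Prod>i\<in>Poly_Mapping.keys \<alpha>. f i ^ Poly_Mapping.lookup \<alpha> i))"
  unfolding poly_subst_def
  by (intro sum.mono_neutral_left assms) (auto simp: in_keys_iff poly_const_def)

lemma poly_subst_add: "poly_subst (p + q) f = poly_subst p f + poly_subst q f"
proof -
  let ?I = "Poly_Mapping.keys p \<union> Poly_Mapping.keys q"
  have "Poly_Mapping.keys (p + q) \<subseteq> ?I" by (rule keys_add)
  then show ?thesis
    by (simp add: poly_subst_superset[of ?I] lookup_add poly_const_def single_add distrib_right sum.distrib)
qed

lemma poly_subst_sum: "poly_subst (sum g A) f = (\<Sum>a\<in>A. poly_subst (g a) f)"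
  by (induction A rule: infinite_finite_induct) (simp_all add: poly_subst_zero poly_subst_add)

lemma poly_subst_single:
  "poly_subst (Poly_Mapping.single \<alpha> c) f =
    poly_const c * (\<Prod>i\<in>Poly_Mapping.keys \<alpha>. f i ^ Poly_Mapping.lookup \<alpha> i)"
  by (simp add: poly_subst_def poly_const_def)

text \<open>Row \<open>i\<close> of the index matrix has a single nonzero entry, whose column occurs
  in the sum because \<open>S \<subseteq> {1..n}\<close>.\<close>

lemma clique_vars_nth:
  assumes "finite S" "S \<subseteq> {1..n}" "i \<in> {1..card S}"
  shows "clique_vars n S i = poly_var (sorted_list_of_set S ! (i - 1))"
proof -
  let ?s = "sorted_list_of_set S ! (i - 1)"
  have "?s \<in> set (sorted_list_of_set S)" using assms by (intro nth_mem) auto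
  then have "?s \<in> {1..n}" using assms by auto
  have "clique_vars n S i = (\<Sum>j=1..n. if j = ?s then poly_var ?s else 0)"
    unfolding clique_vars_def
    by (intro sum.cong) (auto simp: index_matrix_def poly_const_def)
  also have "\<dots> = poly_var ?s" using \<open>?s \<in> {1..n}\<close> by (simp add: sum.delta)
  finally show ?thesis .
qed

text \<open>Renaming the variables of \<open>r\<close> along the increasing enumeration of
  \<open>S\<close> gives \<open>P\<close>, and the substitution undoes the renaming.\<close>

lemma poly_subst_clique_vars_surj:
  assumes S: "finite S" "S \<subseteq> {1..n}" and r: "r \<in> polys_in S"
  obtains P where "P \<in> polys_in {1..card S}" "poly_subst P (clique_vars n S) = r"
proof -
  \<comment> \<open>Variables are numbered from 1 and list positions from 0.\<close>
  define \<sigma> where "\<sigma> i = sorted_list_of_set S ! (i - 1)" for i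
  have "bij_betw ((!) (sorted_list_of_set S)) {..<card S} S"
    using S(1) by (intro bij_betw_nth) auto
  moreover have "bij_betw (\<lambda>i::nat. i - 1) {1..card S} {..<card S}"
    by (rule bij_betw_byWitness[where f' = Suc]) auto
  ultimately have \<sigma>: "bij_betw \<sigma> {1..card S} S"
    using bij_betw_trans[of "\<lambda>i. i - 1" "{1..card S}" "{..<card S}" "(!) (sorted_list_of_set S)" S]
    by (simp add: \<sigma>_def[abs_def] comp_def)
  \<comment> \<open>The exponent of variable \<open>\<sigma> i\<close> in \<alpha> becomes the
    exponent of variable \<open>i\<close>.\<close>
  define \<rho> :: "multi_index \<Rightarrow> multi_index" where
    "\<rho> \<alpha> = (\<Sum>i\<in>{1..card S}. Poly_Mapping.single i (Poly_Mapping.lookup \<alpha> (\<sigma> i)))" for \<alpha>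
  have lookup_\<rho>: "Poly_Mapping.lookup (\<rho> \<alpha>) i = (if i \<in> {1..card S} then Poly_Mapping.lookup \<alpha> (\<sigma> i) else 0)" for \<alpha> i
    unfolding \<rho>_def by (simp add: lookup_sum lookup_single when_def sum.delta)
  have keys_\<rho>: "Poly_Mapping.keys (\<rho> \<alpha>) \<subseteq> {1..card S}" for \<alpha>
    by (auto simp: in_keys_iff lookup_\<rho> split: if_splits)
  have subst: "(\<Prod>i\<in>Poly_Mapping.keys (\<rho> \<alpha>). clique_vars n S i ^ Poly_Mapping.lookup (\<rho> \<alpha>) i) = poly_monom \<alpha>"
    if "Poly_Mapping.keys \<alpha> \<subseteq> S" for \<alpha>
  proof -
    have "(\<Prod>i\<in>Poly_Mapping.keys (\<rho> \<alpha>). clique_vars n S i ^ Poly_Mapping.lookup (\<rho> \<alpha>) i) =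
      (\<Prod>i\<in>{1..card S}. clique_vars n S i ^ Poly_Mapping.lookup (\<rho> \<alpha>) i)"
      using keys_\<rho> by (intro prod.mono_neutral_left) (auto simp: in_keys_iff)
    also have "\<dots> = (\<Prod>i\<in>{1..card S}. poly_var (\<sigma> i) ^ Poly_Mapping.lookup \<alpha> (\<sigma> i))"
      using S by (intro prod.cong refl) (simp add: clique_vars_nth \<sigma>_def lookup_\<rho>)
    also have "\<dots> = (\<Prod>j\<in>S. poly_var j ^ Poly_Mapping.lookup \<alpha> j)"
      using prod.reindex_bij_betw[OF \<sigma>, of "\<lambda>j. poly_var j ^ Poly_Mapping.lookup \<alpha> j"] .
    also have "\<dots> = (\<Prod>j\<in>S. Poly_Mapping.single (Poly_Mapping.single j (Poly_Mapping.lookup \<alpha> j)) 1)"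
    proof (intro prod.cong refl)
      fix j
      have "Poly_Mapping.single (Poly_Mapping.single j 1 :: multi_index) (1 :: real) ^ k =
        Poly_Mapping.single (Poly_Mapping.single j k) 1" for k :: nat
        by (induction k) (simp_all add: mult_single single_add[symmetric])
      then show "poly_var j ^ Poly_Mapping.lookup \<alpha> j =
          Poly_Mapping.single (Poly_Mapping.single j (Poly_Mapping.lookup \<alpha> j)) 1"
        by (simp add: poly_var_def poly_monom_def)
    qed
    also have "\<dots> = Poly_Mapping.single (\<Sum>j\<in>S. Poly_Mapping.single j (Poly_Mapping.lookup \<alpha> j)) 1"
      using S(1) by (induction S rule: finite_induct) (simp_all add: mult_single)
    also have "\<dots> = poly_monom \<alpha>"
      using poly_mapping_sum_single[OF S(1) that, symmetric] by (simp add: poly_monom_def)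
    finally show ?thesis .
  qed
  \<comment> \<open>Written as a sum of single terms, so that additivity of the substitution treats
    each monomial of \<open>r\<close> separately.\<close>
  define P :: real_mpoly where
    "P = (\<Sum>\<alpha>\<in>Poly_Mapping.keys r. Poly_Mapping.single (\<rho> \<alpha>) (Poly_Mapping.lookup r \<alpha>))"
  have "Poly_Mapping.keys P \<subseteq> (\<Union>\<alpha>\<in>Poly_Mapping.keys r. {\<rho> \<alpha>})"
    unfolding P_def by (rule order.trans[OF keys_sum]) auto
  then have "P \<in> polys_in {1..card S}" using keys_\<rho> by (fastforce simp: polys_in_def)
  moreover have "poly_subst P (clique_vars n S) =
    (\<Sum>\<alpha>\<in>Poly_Mapping.keys r. poly_const (Poly_Mapping.lookup r \<alpha>) * poly_monom \<alpha>)"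
    unfolding P_def poly_subst_sum poly_subst_single
    using r by (intro sum.cong refl) (simp add: subst polys_in_def)
  then have "poly_subst P (clique_vars n S) = r"
    using poly_mapping_sum_single[of "Poly_Mapping.keys r" r, symmetric]
    by (simp add: poly_const_def poly_monom_def mult_single)
  ultimately show thesis using that by blast
qed

section \<open>Sparse Gram matrices\<close>

lemma clique_subset: "clique V E K \<Longrightarrow> L \<subseteq> K \<Longrightarrow> clique V E L"
  unfolding clique_def by (meson order.trans subsetD)

lemma clique_change_vertices: "clique V E K \<Longrightarrow> K \<subseteq> W \<Longrightarrow> clique W E K"
  by (simp add: clique_def)

lemma clique_vertices: "clique V E K \<Longrightarrow> K \<subseteq> V"
  by (simp add: clique_def)

lemma clique_adjacent: "clique V E K \<Longrightarrow> i \<in> K \<Longrightarrow> j \<in> K \<Longrightarrow> i \<noteq> j \<Longrightarrow> (i, j) \<in> E"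
  by (simp add: clique_def)

text \<open>Eliminating the monomials that involve a simplicial node creates new nonzero entries
  only between monomials in the variables of its closed neighbourhood. This is a clique, so the
  sparsity pattern survives. The pattern refers to \<open>V\<close> and thereby records which
  variables are already eliminated.\<close>

lemma chordal_sparse_psd_decomposition:
  fixes I :: "multi_index set"
  assumes "sym E" "chordal E" "finite I" "finite V" "psd_on I Q"
    and "\<forall>\<beta>\<in>I. \<forall>\<gamma>\<in>I. Q \<beta> \<gamma> \<noteq> 0 \<longrightarrow>
      clique V E (Poly_Mapping.keys \<beta> \<union> Poly_Mapping.keys \<gamma>)"
  shows "\<exists>vs. (\<forall>\<beta>\<in>I. \<forall>\<gamma>\<in>I. Q \<beta> \<gamma> = (\<Sum>v\<leftarrow>vs. v \<beta> * v \<gamma>)) \<and>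
    (\<forall>v\<in>set vs. \<exists>K. clique V E K \<and> (\<forall>\<beta>\<in>I. v \<beta> \<noteq> 0 \<longrightarrow> Poly_Mapping.keys \<beta> \<subseteq> K))"
  using assms(4-)
proof (induction V arbitrary: Q rule: finite_psubset_induct)
  case (psubset V)
  show ?case
  proof (cases "V = {}")
    case True
    \<comment> \<open>Only the constant monomial can have a nonzero entry now; eliminating all of
      \<open>I\<close> leaves the zero matrix.\<close>
    define K where "K = {0 :: multi_index}"
    have keys_zero: "\<forall>\<beta>\<in>I. \<forall>\<gamma>\<in>I. Q \<beta> \<gamma> \<noteq> 0 \<longrightarrow> \<gamma> \<in> K"
      using psubset.prems(2) True by (auto simp: clique_def K_def)
    from psd_on_eliminate[OF \<open>finite I\<close> psubset.prems(1) \<open>finite I\<close> order.refl keys_zero]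
    obtain Q' vs where Q': "\<forall>\<beta>\<in>I. \<forall>\<gamma>\<in>I. Q \<beta> \<gamma> = Q' \<beta> \<gamma> + (\<Sum>v\<leftarrow>vs. v \<beta> * v \<gamma>)"
      "\<forall>v\<in>set vs. \<forall>\<beta>\<in>I. v \<beta> \<noteq> 0 \<longrightarrow> \<beta> \<in> K" "\<forall>\<beta>\<in>I. \<forall>\<gamma>\<in>I. Q' \<beta> \<gamma> = 0"
      by blast
    have "\<forall>v\<in>set vs. \<exists>K. clique V E K \<and> (\<forall>\<beta>\<in>I. v \<beta> \<noteq> 0 \<longrightarrow> Poly_Mapping.keys \<beta> \<subseteq> K)"
      using Q'(2) by (intro ballI exI[of _ "{}"]) (auto simp: K_def clique_def)
    moreover have "\<forall>\<beta>\<in>I. \<forall>\<gamma>\<in>I. Q \<beta> \<gamma> = (\<Sum>v\<leftarrow>vs. v \<beta> * v \<gamma>)" using Q'(1,3) by simp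
    ultimately show ?thesis by blast
  next
    case False
    with chordal_ex_simplicial[OF psubset.hyps assms(1,2)] obtain s where
      s: "s \<in> V" "clique V E {v \<in> V. v = s \<or> (s, v) \<in> E}" by blast
    \<comment> \<open>\<open>N\<close> is the closed neighbourhood of \<open>s\<close>,
      \<open>A\<close> indexes the rows to be eliminated, and \<open>K\<close> is the set of
      monomials in which those rows are supported.\<close>
    define N where "N = {v \<in> V. v = s \<or> (s, v) \<in> E}"
    have N: "clique V E N" using s by (simp add: N_def)
    define A where "A = {\<beta> \<in> I. s \<in> Poly_Mapping.keys \<beta>}"
    define K where "K = {\<beta> \<in> I. Poly_Mapping.keys \<beta> \<subseteq> N}"
    have AK: "\<forall>\<beta>\<in>A. \<forall>\<gamma>\<in>I. Q \<beta> \<gamma> \<noteq> 0 \<longrightarrow> \<gamma> \<in> K"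
    proof (intro ballI impI)
      fix \<beta> \<gamma> assume "\<beta> \<in> A" "\<gamma> \<in> I" "Q \<beta> \<gamma> \<noteq> 0"
      then have "clique V E (Poly_Mapping.keys \<beta> \<union> Poly_Mapping.keys \<gamma>)" "s \<in> Poly_Mapping.keys \<beta>"
        using psubset.prems(2) by (auto simp: A_def)
      then have "Poly_Mapping.keys \<gamma> \<subseteq> N"
        using clique_vertices clique_adjacent unfolding N_def by fast
      with \<open>\<gamma> \<in> I\<close> show "\<gamma> \<in> K" by (simp add: K_def)
    qed
    have A: "finite A" "A \<subseteq> I" using \<open>finite I\<close> by (auto simp: A_def)
    from psd_on_eliminate[OF \<open>finite I\<close> psubset.prems(1) A AK]
    obtain Q' vs where Q': "psd_on I Q'"
      "\<forall>\<beta>\<in>I. \<forall>\<gamma>\<in>I. Q \<beta> \<gamma> = Q' \<beta> \<gamma> + (\<Sum>v\<leftarrow>vs. v \<beta> * v \<gamma>)"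
      and vsK: "\<forall>v\<in>set vs. \<forall>\<beta>\<in>I. v \<beta> \<noteq> 0 \<longrightarrow> \<beta> \<in> K"
      and Q'A: "\<forall>\<beta>\<in>A. \<forall>\<gamma>\<in>I. Q' \<beta> \<gamma> = 0"
      by blast
    \<comment> \<open>A nonzero entry of \<open>Q'\<close> is either nonzero already in
      \<open>Q\<close> or filled in by some vector of \<open>vs\<close>. In the latter case both
      monomials are in the variables of the clique \<open>N\<close>.\<close>
    have sparse: "clique (V - {s}) E (Poly_Mapping.keys \<beta> \<union> Poly_Mapping.keys \<gamma>)"
      if "\<beta> \<in> I" "\<gamma> \<in> I" "Q' \<beta> \<gamma> \<noteq> 0" for \<beta> \<gamma>
    proof -
      \<comment> \<open>Only rows are known to vanish on \<open>A\<close>; symmetry excludes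
        \<open>s\<close> from the second exponent too.\<close>
      have "Q' \<gamma> \<beta> \<noteq> 0" using Q'(1) that by (auto simp: psd_on_def)
      with Q'A that have "s \<notin> Poly_Mapping.keys \<beta>" "s \<notin> Poly_Mapping.keys \<gamma>"
        by (auto simp: A_def)
      moreover have "clique V E (Poly_Mapping.keys \<beta> \<union> Poly_Mapping.keys \<gamma>)"
      proof (cases "Q \<beta> \<gamma> = 0")
        case False
        then show ?thesis using psubset.prems(2) that by blast
      next
        case True
        then have "(\<Sum>v\<leftarrow>vs. v \<beta> * v \<gamma>) \<noteq> 0" using Q'(2) that by auto
        then obtain v where "v \<in> set vs" "v \<beta> * v \<gamma> \<noteq> 0"
          using sum_list_map_eq_0[of vs "\<lambda>v. v \<beta> * v \<gamma>"] by blast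
        then have "\<beta> \<in> K" "\<gamma> \<in> K" using vsK that by auto
        then have "Poly_Mapping.keys \<beta> \<union> Poly_Mapping.keys \<gamma> \<subseteq> N" by (simp add: K_def)
        then show ?thesis by (rule clique_subset[OF N])
      qed
      moreover from calculation have "Poly_Mapping.keys \<beta> \<union> Poly_Mapping.keys \<gamma> \<subseteq> V - {s}"
        using clique_vertices by fast
      ultimately show ?thesis using clique_change_vertices by blast
    qed
    have "V - {s} \<subset> V" using s(1) by blast
    moreover have "\<forall>\<beta>\<in>I. \<forall>\<gamma>\<in>I. Q' \<beta> \<gamma> \<noteq> 0 \<longrightarrow>
        clique (V - {s}) E (Poly_Mapping.keys \<beta> \<union> Poly_Mapping.keys \<gamma>)"
      using sparse by blast
    ultimately have "\<exists>ws. (\<forall>\<beta>\<in>I. \<forall>\<gamma>\<in>I. Q' \<beta> \<gamma> = (\<Sum>v\<leftarrow>ws. v \<beta> * v \<gamma>)) \<and>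
        (\<forall>v\<in>set ws. \<exists>K. clique (V - {s}) E K \<and> (\<forall>\<beta>\<in>I. v \<beta> \<noteq> 0 \<longrightarrow> Poly_Mapping.keys \<beta> \<subseteq> K))"
      by (rule psubset.IH[OF _ Q'(1)])
    then obtain ws where
      ws: "\<forall>\<beta>\<in>I. \<forall>\<gamma>\<in>I. Q' \<beta> \<gamma> = (\<Sum>v\<leftarrow>ws. v \<beta> * v \<gamma>)"
      "\<forall>v\<in>set ws. \<exists>K. clique (V - {s}) E K \<and> (\<forall>\<beta>\<in>I. v \<beta> \<noteq> 0 \<longrightarrow> Poly_Mapping.keys \<beta> \<subseteq> K)"
      by (elim exE conjE)
    have "\<exists>K. clique V E K \<and> (\<forall>\<beta>\<in>I. v \<beta> \<noteq> 0 \<longrightarrow> Poly_Mapping.keys \<beta> \<subseteq> K)" if "v \<in> set (ws @ vs)" for v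
    proof (cases "v \<in> set ws")
      case True
      then obtain M where M: "clique (V - {s}) E M" "\<forall>\<beta>\<in>I. v \<beta> \<noteq> 0 \<longrightarrow> Poly_Mapping.keys \<beta> \<subseteq> M"
        using ws(2) by blast
      have "M \<subseteq> V" using clique_vertices[OF M(1)] by blast
      with M(1) have "clique V E M" by (rule clique_change_vertices)
      with M(2) show ?thesis by blast
    next
      case False
      with that have "\<forall>\<beta>\<in>I. v \<beta> \<noteq> 0 \<longrightarrow> Poly_Mapping.keys \<beta> \<subseteq> N"
        using vsK by (auto simp: K_def)
      with N show ?thesis by blast
    qed
    moreover have "Q \<beta> \<gamma> = (\<Sum>v\<leftarrow>ws @ vs. v \<beta> * v \<gamma>)" if "\<beta> \<in> I" "\<gamma> \<in> I" for \<beta> \<gamma>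
      using Q'(2) ws(1) that by simp
    ultimately show ?thesis by blast
  qed
qed

section \<open>Passage between sparse Gram matrices and sums over the maximal cliques\<close>

lemma clique_subset_maximal_clique:
  assumes "finite V" "clique V E K"
  obtains D where "maximal_clique V E D" "K \<subseteq> D"
proof -
  have "finite {D. clique V E D \<and> K \<subseteq> D}"
    by (rule finite_subset[of _ "Pow V"]) (use assms in \<open>auto simp: clique_def\<close>)
  from finite_has_maximal2[OF this, of K] assms(2) obtain D where
    D: "clique V E D" "K \<subseteq> D" and
    max: "\<forall>D'\<in>{D. clique V E D \<and> K \<subseteq> D}. D \<subseteq> D' \<longrightarrow> D = D'"
    by auto
  have "maximal_clique V E D"
    unfolding maximal_clique_def
  proof (intro conjI notI D(1))
    assume "\<exists>D'. clique V E D' \<and> D \<subset> D'"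
    then obtain D' where "clique V E D'" "D \<subset> D'" by blast
    with max D(2) show False by blast
  qed
  with D(2) that show thesis by blast
qed

text \<open>The label \<open>g x\<close> will be the number of the maximal clique to which a square
  is assigned.\<close>

lemma sum_filter_partition:
  fixes f :: "'a \<Rightarrow> 'b::comm_monoid_add"
  assumes "finite A" "\<And>x. x \<in> set xs \<Longrightarrow> g x \<in> A"
  shows "(\<Sum>k\<in>A. \<Sum>x\<leftarrow>filter (\<lambda>x. g x = k) xs. f x) = (\<Sum>x\<leftarrow>xs. f x)"
  using assms(2)
proof (induction xs)
  case (Cons x xs)
  have "(\<Sum>k\<in>A. \<Sum>x\<leftarrow>filter (\<lambda>x. g x = k) (x # xs). f x) =
    (\<Sum>k\<in>A. (if g x = k then f x else 0) + (\<Sum>x\<leftarrow>filter (\<lambda>x. g x = k) xs. f x))"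
    by (intro sum.cong) auto
  also have "\<dots> = f x + (\<Sum>x\<leftarrow>xs. f x)"
    using Cons assms(1) by (simp add: sum.distrib sum.delta)
  finally show ?case by simp
qed simp

text \<open>Each rank one term of the decomposed Gram matrix is the square of a polynomial in the
  variables of one clique. Enlarging this to a maximal clique and collecting the squares by clique
  gives the summands.\<close>

lemma SSOS_imp_sum_of_clique_sos:
  assumes "undirected_graph {1..n} E" "chordal E" "p \<in> SSOS n d E"
    and C: "C ` {1..t} = {D. maximal_clique {1..n} E D}"
  obtains r where "\<And>k. k \<in> {1..t::nat} \<Longrightarrow> sos_in (C k) (r k)" "p = (\<Sum>k=1..t. r k)"
proof -
  let ?I = "multi_indices n d"
  from assms(3) obtain Q where psd: "psd_on ?I Q"
    and p: "p = (\<Sum>\<beta>\<in>?I. \<Sum>\<gamma>\<in>?I. Poly_Mapping.single (\<beta> + \<gamma>) (Q \<beta> \<gamma>))"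
    and sparse: "\<And>\<beta> \<gamma> i j. \<beta> \<in> ?I \<Longrightarrow> \<gamma> \<in> ?I \<Longrightarrow> i \<in> {1..n} \<Longrightarrow> j \<in> {1..n} \<Longrightarrow> i \<noteq> j \<Longrightarrow> (i, j) \<notin> E \<Longrightarrow>
      Poly_Mapping.lookup \<beta> i + Poly_Mapping.lookup \<gamma> i \<noteq> 0 \<Longrightarrow>
      Poly_Mapping.lookup \<beta> j + Poly_Mapping.lookup \<gamma> j \<noteq> 0 \<Longrightarrow> Q \<beta> \<gamma> = 0"
    unfolding SSOS_def gram_single by blast
  \<comment> \<open>A node lies in the union of the two supports exactly when its exponents in
    \<beta> and \<gamma> have a nonzero sum, so the pattern of \<open>SSOS\<close> is a clique
    condition.\<close>
  have cliques: "clique {1..n} E (Poly_Mapping.keys \<beta> \<union> Poly_Mapping.keys \<gamma>)"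
    if "\<beta> \<in> ?I" "\<gamma> \<in> ?I" "Q \<beta> \<gamma> \<noteq> 0" for \<beta> \<gamma>
    unfolding clique_def
  proof (intro conjI ballI impI)
    show sub: "Poly_Mapping.keys \<beta> \<union> Poly_Mapping.keys \<gamma> \<subseteq> {1..n}"
      using that by (auto simp: multi_indices_def)
    fix i j assume ij: "i \<in> Poly_Mapping.keys \<beta> \<union> Poly_Mapping.keys \<gamma>"
      "j \<in> Poly_Mapping.keys \<beta> \<union> Poly_Mapping.keys \<gamma>" "i \<noteq> j"
    then have "i \<in> {1..n}" "j \<in> {1..n}" using sub by blast+
    then show "(i, j) \<in> E"
      using sparse[of \<beta> \<gamma> i j] that ij by (auto simp: in_keys_iff)
  qed
  have "sym E" using assms(1) by (simp add: undirected_graph_def)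
  from chordal_sparse_psd_decomposition[OF this assms(2) finite_multi_indices finite_atLeastAtMost psd] cliques
  obtain vs where vs: "\<forall>\<beta>\<in>?I. \<forall>\<gamma>\<in>?I. Q \<beta> \<gamma> = (\<Sum>v\<leftarrow>vs. v \<beta> * v \<gamma>)"
    and vs_clique: "\<forall>v\<in>set vs.
      \<exists>K. clique {1..n} E K \<and> (\<forall>\<beta>\<in>?I. v \<beta> \<noteq> 0 \<longrightarrow> Poly_Mapping.keys \<beta> \<subseteq> K)"
    by blast
  have "\<exists>k\<in>{1..t}. \<forall>\<beta>\<in>?I. v \<beta> \<noteq> 0 \<longrightarrow> Poly_Mapping.keys \<beta> \<subseteq> C k" if v: "v \<in> set vs" for v
  proof -
    from vs_clique v obtain K where K: "clique {1..n} E K"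
      "\<forall>\<beta>\<in>?I. v \<beta> \<noteq> 0 \<longrightarrow> Poly_Mapping.keys \<beta> \<subseteq> K" by blast
    from K(1) obtain D where "maximal_clique {1..n} E D" "K \<subseteq> D"
      by (rule clique_subset_maximal_clique[OF finite_atLeastAtMost])
    moreover from this C obtain k where "k \<in> {1..t}" "D = C k" by blast
    ultimately show ?thesis using K(2) by blast
  qed
  \<comment> \<open>A clique may lie in several maximal ones; \<open>g\<close> selects one of them,
    so each square is counted once.\<close>
  then obtain g where g: "\<And>v. v \<in> set vs \<Longrightarrow> g v \<in> {1..t}"
    "\<And>v \<beta>. v \<in> set vs \<Longrightarrow> \<beta> \<in> ?I \<Longrightarrow> v \<beta> \<noteq> 0 \<Longrightarrow> Poly_Mapping.keys \<beta> \<subseteq> C (g v)"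
    by metis
  define q where "q v = (\<Sum>\<beta>\<in>?I. Poly_Mapping.single \<beta> (v \<beta>))" for v :: "multi_index \<Rightarrow> real"
  have q_in: "q v \<in> polys_in (C (g v))" if "v \<in> set vs" for v
  proof -
    have "Poly_Mapping.keys (q v) \<subseteq> {\<beta> \<in> ?I. v \<beta> \<noteq> 0}"
      unfolding q_def by (rule order.trans[OF keys_sum]) auto
    then show ?thesis using g(2)[OF that] by (auto simp: polys_in_def)
  qed
  define r where "r k = (\<Sum>v\<leftarrow>filter (\<lambda>v. g v = k) vs. (q v)\<^sup>2)" for k
  show thesis
  proof (rule that[of r])
    fix k assume "k \<in> {1..t}"
    show "sos_in (C k) (r k)"
      unfolding sos_in_def r_def
      by (rule exI[of _ "map q (filter (\<lambda>v. g v = k) vs)"]) (use q_in in \<open>auto simp: comp_def\<close>)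
  next
    have "p = (\<Sum>\<beta>\<in>?I. \<Sum>\<gamma>\<in>?I. Poly_Mapping.single (\<beta> + \<gamma>) (\<Sum>v\<leftarrow>vs. v \<beta> * v \<gamma>))"
      unfolding p by (intro sum.cong refl) (simp add: vs)
    also have "\<dots> = (\<Sum>v\<leftarrow>vs. (q v)\<^sup>2)" by (simp add: sum_list_squares_single q_def)
    also have "\<dots> = (\<Sum>k=1..t. r k)"
      unfolding r_def using g(1) by (intro sum_filter_partition[symmetric]) auto
    finally show "p = (\<Sum>k=1..t. r k)" .
  qed
qed

text \<open>The Gram matrix is the sum of the outer products of the coefficient vectors of all
  squares. Two monomials of one square have all their variables in one clique, which yields the
  sparsity.\<close>

lemma sum_of_clique_sos_imp_SSOS:
  fixes t :: nat
  assumes p: "p \<in> polys_upto n (2 * d)" "p = (\<Sum>k=1..t. r k)"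
    and sos: "\<And>k. k \<in> {1..t} \<Longrightarrow> sos_in (C k) (r k)"
    and C: "\<And>k. k \<in> {1..t} \<Longrightarrow> clique {1..n} E (C k)"
  shows "p \<in> SSOS n d E"
proof -
  let ?I = "multi_indices n d"
  from sos have "\<forall>k\<in>{1..t}. \<exists>qs. set qs \<subseteq> polys_in (C k) \<and> r k = (\<Sum>q\<leftarrow>qs. q ^ 2)"
    by (simp add: sos_in_def)
  then obtain qs where qs: "\<And>k. k \<in> {1..t} \<Longrightarrow> set (qs k) \<subseteq> polys_in (C k)"
    "\<And>k. k \<in> {1..t} \<Longrightarrow> r k = (\<Sum>q\<leftarrow>qs k. q ^ 2)" by metis
  \<comment> \<open>The squares of all cliques form one list, because the degree bound is given for
    the total \<open>p\<close> and not for each \<open>r k\<close>.\<close>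
  define L where "L = concat (map qs [1..<Suc t])"
  have "(\<Sum>q\<leftarrow>concat (map qs ks). q ^ 2) = (\<Sum>k\<leftarrow>ks. \<Sum>q\<leftarrow>qs k. q ^ 2)" for ks
    by (induction ks) simp_all
  then have "(\<Sum>q\<leftarrow>L. q ^ 2) = (\<Sum>k\<leftarrow>[1..<Suc t]. \<Sum>q\<leftarrow>qs k. q ^ 2)"
    by (simp add: L_def)
  also have "\<dots> = (\<Sum>k=1..t. \<Sum>q\<leftarrow>qs k. q ^ 2)"
    by (simp add: interv_sum_list_conv_sum_set_nat atLeastLessThanSuc_atLeastAtMost del: upt_Suc)
  also have "\<dots> = p" unfolding p(2) by (intro sum.cong) (simp_all add: qs)
  finally have pL: "p = (\<Sum>q\<leftarrow>L. q ^ 2)" by simp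
  have L_clique: "\<exists>K. clique {1..n} E K \<and> q \<in> polys_in K" if "q \<in> set L" for q
    using that qs(1) C by (fastforce simp: L_def)
  then have "set L \<subseteq> polys_in {1..n}" by (fastforce simp: polys_in_def clique_def)
  with p(1) pL have L_keys: "Poly_Mapping.keys q \<subseteq> ?I" if "q \<in> set L" for q
    using multi_indices_degree_sum_squares[of L n d q] that by simp
  define vs where "vs = map Poly_Mapping.lookup L"
  define Q where "Q \<beta> \<gamma> = (\<Sum>v\<leftarrow>vs. v \<beta> * v \<gamma>)" for \<beta> \<gamma>
  have "p = (\<Sum>q\<leftarrow>L. (\<Sum>\<alpha>\<in>?I. Poly_Mapping.single \<alpha> (Poly_Mapping.lookup q \<alpha>))\<^sup>2)"
    unfolding pL using poly_mapping_sum_single[OF finite_multi_indices L_keys]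
    by (intro arg_cong[of _ _ sum_list] map_cong) metis+
  then have "p = (\<Sum>\<beta>\<in>?I. \<Sum>\<gamma>\<in>?I. Poly_Mapping.single (\<beta> + \<gamma>) (Q \<beta> \<gamma>))"
    using sum_list_squares_single[of ?I vs] by (simp add: vs_def Q_def comp_def)
  moreover have "psd_on ?I Q"
  proof -
    have "0 \<le> quad_form ?I Q w" for w
    proof -
      have "quad_form ?I Q w = (\<Sum>v\<leftarrow>vs. \<Sum>\<beta>\<in>?I. \<Sum>\<gamma>\<in>?I. w \<beta> * v \<beta> * (w \<gamma> * v \<gamma>))"
        by (simp add: quad_form_def Q_def sum_sum_list_swap sum_list_const_mult[symmetric]
            sum_list_mult_const[symmetric] algebra_simps)
      also have "\<dots> = (\<Sum>v\<leftarrow>vs. (\<Sum>\<beta>\<in>?I. w \<beta> * v \<beta>)\<^sup>2)"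
        by (simp add: power2_eq_square sum_product)
      also have "\<dots> \<ge> 0" by (intro sum_list_nonneg) auto
      finally show ?thesis .
    qed
    then show ?thesis by (simp add: psd_on_quad_form Q_def mult.commute)
  qed
  moreover have "Q \<beta> \<gamma> = 0"
    if "(i, j) \<notin> E" "i \<noteq> j" and ij: "Poly_Mapping.lookup \<beta> i + Poly_Mapping.lookup \<gamma> i \<noteq> 0"
      "Poly_Mapping.lookup \<beta> j + Poly_Mapping.lookup \<gamma> j \<noteq> 0" for \<beta> \<gamma> i j
  proof -
    have "Poly_Mapping.lookup q \<beta> * Poly_Mapping.lookup q \<gamma> = 0" if "q \<in> set L" for q
    proof (rule ccontr)
      assume "Poly_Mapping.lookup q \<beta> * Poly_Mapping.lookup q \<gamma> \<noteq> 0"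
      then have "\<beta> \<in> Poly_Mapping.keys q" "\<gamma> \<in> Poly_Mapping.keys q" by (auto simp: in_keys_iff)
      with L_clique[OF that] obtain K where "clique {1..n} E K"
        "Poly_Mapping.keys \<beta> \<subseteq> K" "Poly_Mapping.keys \<gamma> \<subseteq> K" by (auto simp: polys_in_def)
      moreover have "i \<in> Poly_Mapping.keys \<beta> \<union> Poly_Mapping.keys \<gamma>"
        "j \<in> Poly_Mapping.keys \<beta> \<union> Poly_Mapping.keys \<gamma>"
        using ij by (auto simp: in_keys_iff)
      ultimately show False using \<open>(i, j) \<notin> E\<close> \<open>i \<noteq> j\<close> unfolding clique_def by blast
    qed
    then show ?thesis by (auto simp: Q_def vs_def intro!: sum_list_map_eq_0)
  qed
  ultimately show ?thesis
    unfolding SSOS_def gram_single using p(1) by blast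
qed

theorem theorem2:
  fixes n d t :: nat
    and E :: "(nat \<times> nat) set"
    and C :: "nat \<Rightarrow> nat set"
    and p :: real_mpoly
  assumes "undirected_graph {1..n} E"
    and "chordal E"
    and "bij_betw C {1..t} {D. maximal_clique {1..n} E D}"
    and "p \<in> polys_upto n (2 * d)"
  shows "p \<in> SSOS n d E \<longleftrightarrow>
    (\<exists>P :: nat \<Rightarrow> real_mpoly.
       (\<forall>k\<in>{1..t}. P k \<in> polys_in {1..card (C k)} \<and>
          sos_in (C k) (poly_subst (P k) (clique_vars n (C k)))) \<and>
       p = (\<Sum>k=1..t. poly_subst (P k) (clique_vars n (C k))))"
proof -
  note C = bij_betw_imp_surj_on[OF assms(3)]
  have Ck: "maximal_clique {1..n} E (C k)" if "k \<in> {1..t}" for k using C that by blast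
  then have clique: "clique {1..n} E (C k)" if "k \<in> {1..t}" for k
    using that by (simp add: maximal_clique_def)
  then have sub: "C k \<subseteq> {1..n}" if "k \<in> {1..t}" for k
    using that by (simp add: clique_def)
  have fin: "finite (C k)" if "k \<in> {1..t}" for k
    using sub[OF that] finite_subset by blast
  show ?thesis
  proof
    assume "p \<in> SSOS n d E"
    then obtain r where r: "\<And>k. k \<in> {1..t} \<Longrightarrow> sos_in (C k) (r k)" "p = (\<Sum>k=1..t. r k)"
      using SSOS_imp_sum_of_clique_sos[OF assms(1,2) _ C] by blast
    \<comment> \<open>The summands are so far polynomials in the original variables and have to be
      written as substitution instances.\<close>
    have "\<exists>P. P \<in> polys_in {1..card (C k)} \<and> poly_subst P (clique_vars n (C k)) = r k"
      if "k \<in> {1..t}" for k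
      using poly_subst_clique_vars_surj[OF fin sub polys_in_sos[OF r(1)]] that by blast
    then obtain P where "\<And>k. k \<in> {1..t} \<Longrightarrow>
        P k \<in> polys_in {1..card (C k)} \<and> poly_subst (P k) (clique_vars n (C k)) = r k" by metis
    with r show "\<exists>P. (\<forall>k\<in>{1..t}. P k \<in> polys_in {1..card (C k)} \<and>
          sos_in (C k) (poly_subst (P k) (clique_vars n (C k)))) \<and>
        p = (\<Sum>k=1..t. poly_subst (P k) (clique_vars n (C k)))"
      by (intro exI[of _ P]) auto
  next
    assume "\<exists>P. (\<forall>k\<in>{1..t}. P k \<in> polys_in {1..card (C k)} \<and>
          sos_in (C k) (poly_subst (P k) (clique_vars n (C k)))) \<and>
        p = (\<Sum>k=1..t. poly_subst (P k) (clique_vars n (C k)))"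
    then obtain P where "\<And>k. k \<in> {1..t} \<Longrightarrow> sos_in (C k) (poly_subst (P k) (clique_vars n (C k)))"
      "p = (\<Sum>k=1..t. poly_subst (P k) (clique_vars n (C k)))" by blast
    then show "p \<in> SSOS n d E"
      using sum_of_clique_sos_imp_SSOS[OF assms(4), where t = t and C = C] clique by blast
  qed
qed

end
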